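(* Let $n,d\in\mathbb{N}$, $k,s\in\mathbb{Z}$ be such that $d\mid n$. Then $$T_n(k,s,d)=\begin{cases}\displaystyle \frac{n}{d}\sum_{\substack{\delta\mid n\\ (\delta,d)=1\\ \frac{n}{d\delta}\mid k}}\frac{\mu(\delta)}{\delta}\, e(\delta\delta' k/n), & \text{if } (s,d)=1,\\ 0, & \text{otherwise},\end{cases}$$ where, for each $\delta$ occurring in the sum, $\delta'\in\mathbb{Z}$ is any integer such that $\delta\delta'\equiv s\pmod d$.
   Context: $\mathbb{N}=\{1,2,\ldots\}$; $(a,b)$ is the greatest common divisor of $a,b\in\mathbb{Z}$; $\mu$ is the Möbius function; $e(x)=e^{2\pi i x}$ for $x\in\mathbb{R}$. All divisors in sums are positive. For $n,d\in\mathbb{N}$ and $k,s\in\mathbb{Z}$, $$T_n(k,s,d):=\sum_{\substack{a=1\\ (a,n)=1\\ a\equiv s\ (\mathrm{mod}\ d)}}^n e(ak/n).$$ *)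

theory Defs
  imports
    Complex_Main
    "HOL-Computational_Algebra.Squarefree"
    "HOL-Number_Theory.Cong"
begin

definition mu :: "nat \<Rightarrow> int" where
  "mu n = (if squarefree n then (- 1) ^ card (prime_factors n) else 0)"

definition e :: "real \<Rightarrow> complex" where
  "e x = exp (2 * of_real pi * \<i> * of_real x)"

definition T :: "nat \<Rightarrow> int \<Rightarrow> int \<Rightarrow> nat \<Rightarrow> complex" where
  "T n k s d =
     (\<Sum>a | a \<in> {1..n} \<and> coprime a n \<and> [int a = s] (mod int d).
        e (of_nat a * of_int k / of_nat n))"

text \<open>
  For \<open>d dvd n\<close>, the conditions \<open>\<delta> dvd n\<close> and \<open>coprime \<delta> d\<close> give \<open>d * \<delta> dvd n\<close>,
  so the integer quotient \<open>n div (d * \<delta>)\<close> below is exact.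
\<close>

definition deltas :: "nat \<Rightarrow> int \<Rightarrow> nat \<Rightarrow> nat set" where
  "deltas n k d =
     {\<delta>. \<delta> dvd n \<and> coprime \<delta> d \<and> int (n div (d * \<delta>)) dvd k}"

end

theory Submission
  imports Defs
begin

text \<open>
  The condition \<open>coprime a n\<close> is detected by \<open>\<Sum>\<delta> dvd gcd a n. mu \<delta>\<close>. Exchanging the two
  summations leaves, for each \<open>\<delta> dvd n\<close>, an unrestricted exponential sum over the
  \<open>a \<le> n\<close> with \<open>\<delta> dvd a\<close> and \<open>a \<equiv> s (mod d)\<close>.

  Let \<open>coprime s d\<close>. If \<open>\<delta>\<close> and \<open>d\<close> have a common prime factor, no such \<open>a\<close> exists, since that
  prime would divide \<open>s\<close>. Otherwise the two conditions amount, by the Chinese remainder theorem, to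
  the single congruence \<open>a \<equiv> \<delta> * \<delta>' (mod d * \<delta>)\<close>, whose modulus divides \<open>n\<close>. The sum of
  \<open>e (a * k / n)\<close> over a residue class modulo a divisor \<open>m\<close> of \<open>n\<close> is a geometric sum over all
  powers of an \<open>n div m\<close>-th root of unity (lemma \<open>sum_e_residue_class\<close>), so it vanishes
  unless \<open>n div m\<close> divides \<open>k\<close>, and then all its \<open>n div m\<close> terms are equal.
  With \<open>m = d * \<delta>\<close> this is the stated formula.
  If \<open>s\<close> and \<open>d\<close> are not coprime, the sum defining \<open>T\<close> is empty.
\<close>

section \<open>The divisor sum of the Moebius function\<close>

lemma mu_prime_mult:
  assumes "prime p" and "\<not> p dvd x" and "squarefree x"
  shows "mu (p * x) = - mu x"
proof -
  have x0: "x \<noteq> 0"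
    using assms(2) by (metis dvd_0_right)
  have cop: "coprime p x"
    using assms(1,2) by (simp add: prime_imp_coprime)
  have sq: "squarefree (p * x)"
    using cop assms(1,3) by (simp add: squarefree_mult_coprime squarefree_prime)
  have "prime_factors (p * x) = insert p (prime_factors x)"
    using assms(1) x0 by (simp add: prime_factors_product prime_prime_factors)
  moreover have "p \<notin> prime_factors x"
    using assms(2) by auto
  ultimately show ?thesis
    using sq assms(3) by (simp add: mu_def)
qed

text \<open>
  If a prime \<open>p\<close> divides \<open>m\<close>, the squarefree divisors of \<open>m\<close> fall into pairs
  \<open>x\<close>, \<open>p * x\<close> with \<open>p\<close> not dividing \<open>x\<close>, and \<open>mu\<close> takes opposite values on each pair.
\<close>

lemma sum_mu_divisors:
  assumes "m > 0"
  shows "(\<Sum>x | x dvd m. mu x) = (if m = 1 then 1 else 0)"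
proof (cases "m = 1")
  case True
  have "{x. x dvd m} = {1}" using True by auto
  then show ?thesis using True by (simp add: mu_def)
next
  case False
  then obtain p where p: "prime p" "p dvd m"
    using prime_factor_nat by blast
  have p0: "p > 0" using p(1) by (rule prime_gt_0_nat)
  define D where "D = {x. x dvd m \<and> squarefree x \<and> \<not> p dvd x}"
  have fin: "finite {x. x dvd m}" using assms by simp
  then have finD: "finite D" unfolding D_def by (rule rev_finite_subset) auto
  have split: "{x. x dvd m \<and> squarefree x} = D \<union> (\<lambda>x. p * x) ` D"
  proof (intro equalityI subsetI)
    fix x assume x: "x \<in> {x. x dvd m \<and> squarefree x}"
    show "x \<in> D \<union> (\<lambda>x. p * x) ` D"
    proof (cases "p dvd x")
      case True
      then obtain y where y: "x = p * y" by (elim dvdE)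
      have "y dvd m" using x y by (auto dest: dvd_mult_right)
      moreover have "squarefree y"
        using x y by (auto intro: squarefree_mono[of y x])
      moreover have "\<not> p dvd y"
      proof
        assume "p dvd y"
        then have "p ^ 2 dvd x" unfolding y power2_eq_square by (simp add: mult_dvd_mono)
        then have "is_unit p" using x unfolding squarefree_def by blast
        then show False using p(1) not_prime_unit by blast
      qed
      ultimately show ?thesis using y by (auto simp: D_def)
    qed (use x in \<open>auto simp: D_def\<close>)
  next
    fix x assume "x \<in> D \<union> (\<lambda>x. p * x) ` D"
    then consider "x \<in> D" | y where "y \<in> D" "x = p * y" by auto
    then show "x \<in> {x. x dvd m \<and> squarefree x}"
    proof cases
      case 2
      have cop: "coprime p y" using 2 p(1) by (auto simp: D_def intro: prime_imp_coprime)
      then show ?thesis using 2 p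
        by (auto simp: D_def squarefree_mult_coprime squarefree_prime intro: divides_mult)
    qed (auto simp: D_def)
  qed
  have "(\<Sum>x | x dvd m. mu x) = (\<Sum>x | x dvd m \<and> squarefree x. mu x)"
    by (rule sum.mono_neutral_right[OF fin]) (auto simp: mu_def)
  also have "\<dots> = (\<Sum>x\<in>D. mu x) + (\<Sum>x\<in>(\<lambda>x. p * x) ` D. mu x)"
    unfolding split using finD by (intro sum.union_disjoint) (auto simp: D_def)
  also have "(\<Sum>x\<in>(\<lambda>x. p * x) ` D. mu x) = (\<Sum>x\<in>D. mu (p * x))"
    using p0 by (subst sum.reindex) (auto simp: inj_on_def)
  also have "\<dots> = (\<Sum>x\<in>D. - mu x)"
    by (rule sum.cong) (auto simp: D_def mu_prime_mult p(1))
  finally show ?thesis using False by (simp add: sum_negf)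
qed

section \<open>Exponential sums over residue classes\<close>

lemma e_add: "e (x + y) = e x * e y"
  by (simp add: e_def exp_add algebra_simps)

lemma e_of_nat_mult: "e (of_nat j * x) = e x ^ j"
  by (simp add: e_def exp_of_nat_mult [symmetric] algebra_simps)

lemma e_eq_1_iff: "e x = 1 \<longleftrightarrow> x \<in> \<int>"
proof -
  have "e x = cis (2 * pi * x)"
    by (simp add: e_def cis_conv_exp algebra_simps)
  then have "e x = 1 \<longleftrightarrow> cos (2 * pi * x) = 1"
    by (auto simp: complex_eq_iff cos_one_sin_zero)
  also have "\<dots> \<longleftrightarrow> x \<in> \<int>"
    by (auto simp: cos_one_2pi_int Ints_def)
  finally show ?thesis .
qed

lemma of_int_divide_in_Ints_iff:
  assumes "N > 0"
  shows "real_of_int k / real N \<in> \<int> \<longleftrightarrow> int N dvd k"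
proof
  assume "real_of_int k / real N \<in> \<int>"
  then obtain t where "real_of_int k / real N = of_int t" by (elim Ints_cases)
  then have "real_of_int k = of_int (int N * t)"
    using assms by (simp add: field_simps)
  then have "k = int N * t" by (simp only: of_int_eq_iff)
  then show "int N dvd k" by simp
qed (use assms in \<open>auto elim!: dvdE\<close>)

lemma sum_e_root_of_unity:
  assumes "N > 0"
  shows "(\<Sum>j<N. e (of_int k / of_nat N) ^ j) = (if int N dvd k then of_nat N else 0)"
proof (cases "int N dvd k")
  case True
  then have "e (of_int k / of_nat N) = 1"
    using assms by (simp add: e_eq_1_iff of_int_divide_in_Ints_iff)
  then show ?thesis using True by simp
next
  case False
  then have "e (of_int k / of_nat N) \<noteq> 1"
    using assms by (simp add: e_eq_1_iff of_int_divide_in_Ints_iff)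
  moreover have "e (of_int k / of_nat N) ^ N = 1"
    using assms by (simp add: e_of_nat_mult [symmetric] e_eq_1_iff)
  ultimately show ?thesis using False by (simp add: geometric_sum)
qed

text \<open>
  The residue class of \<open>c\<close> modulo \<open>m\<close> meets \<open>{1..n}\<close> in a progression \<open>r + m * j\<close> with
  \<open>j < n div m\<close>, which makes the sum geometric with ratio \<open>e (k / (n div m))\<close>. When
  \<open>n div m\<close> divides \<open>k\<close>, every representative of the class gives the same
  value \<open>e (c * k / n)\<close>.
\<close>

lemma sum_e_residue_class:
  fixes n m :: nat and c k :: int
  assumes n: "n > 0" and mn: "m dvd n"
  shows "(\<Sum>a | a \<in> {1..n} \<and> [int a = c] (mod int m). e (of_nat a * of_int k / of_nat n)) =
    (if int (n div m) dvd k
     then of_nat n / of_nat m * e (of_int c * of_int k / of_nat n) else 0)"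
proof -
  define N where "N = n div m"
  have nN: "n = m * N" using mn by (simp add: N_def)
  have m0: "m > 0" and N0: "N > 0" using n nN by auto
  \<comment> \<open>The representative of \<open>c\<close> is taken in \<open>{1..m}\<close>, in accordance with the range \<open>{1..n}\<close>.\<close>
  define r where "r = nat ((c - 1) mod int m) + 1"
  have r: "1 \<le> r" "r \<le> m"
    using m0 by (auto simp: r_def Suc_le_eq nat_less_iff)
  have "int r = (c - 1) mod int m + 1"
    using m0 by (simp add: r_def)
  then have "[int r = (c - 1) + 1] (mod int m)"
    by (simp add: cong_def mod_add_left_eq)
  then have rc: "[int r = c] (mod int m)" by simp
  have set_eq: "{a. a \<in> {1..n} \<and> [int a = c] (mod int m)} = (\<lambda>j. r + m * j) ` {..<N}"
  proof (intro equalityI subsetI)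
    fix a assume "a \<in> {a. a \<in> {1..n} \<and> [int a = c] (mod int m)}"
    then have a: "1 \<le> a" "a \<le> n" and "[int a = int r] (mod int m)"
      using rc by (auto intro: cong_trans cong_sym)
    then have ar: "[a = r] (mod m)" by (simp add: cong_int_iff)
    have "r \<le> a"
    proof (rule ccontr)
      assume "\<not> r \<le> a"
      then have "m dvd r - a" using ar by (metis cong_sym cong_altdef_nat nat_le_linear)
      moreover have "0 < r - a" "r - a < m" using \<open>\<not> r \<le> a\<close> r a by auto
      ultimately show False using nat_dvd_not_less by blast
    qed
    then have "m dvd a - r" using ar by (simp add: cong_altdef_nat)
    then obtain j where j: "a - r = m * j" by (elim dvdE)
    then have "a = r + m * j" using \<open>r \<le> a\<close> by simp
    moreover have "m * j < m * N" using j r a nN by linarith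
    then have "j < N" by simp
    ultimately show "a \<in> (\<lambda>j. r + m * j) ` {..<N}" by auto
  next
    fix a assume "a \<in> (\<lambda>j. r + m * j) ` {..<N}"
    then obtain j where j: "j < N" "a = r + m * j" by auto
    have "m * Suc j \<le> m * N" using j by (intro mult_le_mono2) simp
    then have "a \<le> n" using j r nN by simp
    moreover have "[int a = c] (mod int m)"
      using rc j by (simp add: cong_def)
    ultimately show "a \<in> {a. a \<in> {1..n} \<and> [int a = c] (mod int m)}"
      using j r by simp
  qed
  have "(\<Sum>a | a \<in> {1..n} \<and> [int a = c] (mod int m). e (of_nat a * of_int k / of_nat n)) =
      (\<Sum>j<N. e (of_nat (r + m * j) * of_int k / of_nat n))"
    unfolding set_eq using m0 by (subst sum.reindex) (auto simp: inj_on_def)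
  also have "\<dots> = (\<Sum>j<N. e (of_nat r * of_int k / of_nat n) * e (of_int k / of_nat N) ^ j)"
  proof (rule sum.cong)
    fix j assume "j \<in> {..<N}"
    have "real (r + m * j) * of_int k / of_nat n =
        of_nat r * of_int k / of_nat n + of_nat j * (of_int k / of_nat N)"
      using m0 N0 by (simp add: nN field_simps)
    then show "e (of_nat (r + m * j) * of_int k / of_nat n) =
        e (of_nat r * of_int k / of_nat n) * e (of_int k / of_nat N) ^ j"
      by (simp only: e_add e_of_nat_mult)
  qed simp
  also have "\<dots> = e (of_nat r * of_int k / of_nat n) * (if int N dvd k then of_nat N else 0)"
    by (simp add: sum_distrib_left [symmetric] sum_e_root_of_unity[OF N0])
  also have "\<dots> = (if int N dvd k
     then of_nat n / of_nat m * e (of_int c * of_int k / of_nat n) else 0)"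
  proof (cases "int N dvd k")
    case True
    obtain u where u: "int r = c + int m * u"
      using rc by (metis cong_iff_lin cong_sym)
    have "real r = of_int c + real m * of_int u"
      using arg_cong[OF u, of real_of_int] by simp
    then have "real r * of_int k / of_nat n =
        of_int c * of_int k / of_nat n + of_int (u * k) / of_nat N"
      using m0 N0 by (simp add: nN field_simps)
    moreover have "e (of_int (u * k) / of_nat N) = 1"
      using True N0 by (subst e_eq_1_iff, subst of_int_divide_in_Ints_iff) auto
    ultimately have "e (of_nat r * of_int k / of_nat n) = e (of_int c * of_int k / of_nat n)"
      by (simp only: e_add mult_1_right)
    then show ?thesis using True m0 by (simp add: nN)
  qed simp
  finally show ?thesis by (simp add: N_def)
qed

section \<open>Evaluation of the restricted sum\<close>

text \<open>
  The number \<open>\<delta> * x\<close> itself satisfies both conditions on the left, and by the Chinese remainder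
  theorem the solutions form a single class modulo \<open>d * \<delta>\<close>.
\<close>

lemma dvd_and_cong_iff_cong_mult:
  fixes a x \<delta> d s :: int
  assumes cop: "coprime \<delta> d" and x: "[\<delta> * x = s] (mod d)"
  shows "\<delta> dvd a \<and> [a = s] (mod d) \<longleftrightarrow> [a = \<delta> * x] (mod (d * \<delta>))"
proof -
  have "[a = s] (mod d) \<longleftrightarrow> [a = \<delta> * x] (mod d)"
    using x by (meson cong_sym cong_trans)
  moreover have "\<delta> dvd a \<longleftrightarrow> [a = \<delta> * x] (mod \<delta>)"
    by (simp add: cong_def dvd_eq_mod_eq_0)
  moreover have "[a = \<delta> * x] (mod d) \<and> [a = \<delta> * x] (mod \<delta>)
      \<longleftrightarrow> [a = \<delta> * x] (mod (d * \<delta>))"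
    using cop by (auto simp: cong_iff_dvd_diff coprime_commute
        intro: divides_mult dvd_mult_left dvd_mult_right)
  ultimately show ?thesis by blast
qed

theorem lemma4p1:
  fixes n d :: nat and k s :: int and \<delta>' :: "nat \<Rightarrow> int"
  assumes "n \<ge> 1" and "d \<ge> 1" and "d dvd n"
    and "\<And>\<delta>. coprime s (int d) \<Longrightarrow> \<delta> \<in> deltas n k d \<Longrightarrow>
           [int \<delta> * \<delta>' \<delta> = s] (mod int d)"
  shows "T n k s d =
    (if coprime s (int d)
     then of_nat n / of_nat d *
       (\<Sum>\<delta>\<in>deltas n k d. of_int (mu \<delta>) / of_nat \<delta> *
          e (of_nat \<delta> * of_int (\<delta>' \<delta>) * of_int k / of_nat n))
     else 0)"
proof (cases "coprime s (int d)")
  case False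
  have "{a. a \<in> {1..n} \<and> coprime a n \<and> [int a = s] (mod int d)} = {}"
  proof (intro equals0I)
    fix a assume "a \<in> {a. a \<in> {1..n} \<and> coprime a n \<and> [int a = s] (mod int d)}"
    then have "coprime a n" and as: "[int a = s] (mod int d)" by auto
    then have "coprime (int a) (int d)"
      using assms(3) by (auto intro: coprime_divisors[of a a d n])
    then show False using as False cong_imp_coprime by blast
  qed
  then have "T n k s d = 0" unfolding T_def by (simp only: sum.empty)
  then show ?thesis using False by simp
next
  case True
  define f where "f a = e (of_nat a * of_int k / of_nat n)" for a :: nat
  define A where "A = {a. a \<in> {1..n} \<and> [int a = s] (mod int d)}"
  define S where "S \<delta> = (\<Sum>a | a \<in> A \<and> \<delta> dvd a. f a)" for \<delta>
  have class_eq: "{a. a \<in> A \<and> \<delta> dvd a} =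
      {a. a \<in> {1..n} \<and> [int a = int \<delta> * x] (mod int (d * \<delta>))}"
    if "coprime \<delta> d" and x: "[int \<delta> * x = s] (mod int d)" for \<delta> x
  proof -
    have "coprime (int \<delta>) (int d)" using that(1) by simp
    note iff = dvd_and_cong_iff_cong_mult[OF this x]
    have "\<delta> dvd a \<and> [int a = s] (mod int d)
        \<longleftrightarrow> [int a = int \<delta> * x] (mod int (d * \<delta>))" for a
      using iff[of "int a"] by (simp only: int_dvd_int_iff of_nat_mult)
    then show ?thesis unfolding A_def by blast
  qed
  have finA: "finite A" unfolding A_def by simp
  have finD: "finite {\<delta>. \<delta> dvd n}" using assms(1) by simp
  have "T n k s d = (\<Sum>a\<in>A. if coprime a n then f a else 0)"
    unfolding T_def f_def A_def
    by (subst sum.inter_filter [symmetric]) (auto intro!: sum.cong)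
  also have "\<dots> = (\<Sum>a\<in>A. \<Sum>\<delta> | \<delta> \<in> {\<delta>. \<delta> dvd n} \<and> \<delta> dvd a. of_int (mu \<delta>) * f a)"
  proof (rule sum.cong)
    fix a assume "a \<in> A"
    have "{\<delta>. \<delta> \<in> {\<delta>. \<delta> dvd n} \<and> \<delta> dvd a} = {\<delta>. \<delta> dvd gcd a n}" by auto
    then have "(\<Sum>\<delta> | \<delta> \<in> {\<delta>. \<delta> dvd n} \<and> \<delta> dvd a. of_int (mu \<delta>) * f a) =
        of_int (\<Sum>\<delta> | \<delta> dvd gcd a n. mu \<delta>) * f a"
      by (simp only: of_int_sum sum_distrib_right)
    also have "\<dots> = (if coprime a n then f a else 0)"
      using assms(1) by (subst sum_mu_divisors) (auto simp: coprime_iff_gcd_eq_1)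
    finally show "(if coprime a n then f a else 0) =
        (\<Sum>\<delta> | \<delta> \<in> {\<delta>. \<delta> dvd n} \<and> \<delta> dvd a. of_int (mu \<delta>) * f a)" ..
  qed simp
  also have "\<dots> = (\<Sum>\<delta> | \<delta> dvd n. \<Sum>a | a \<in> A \<and> \<delta> dvd a. of_int (mu \<delta>) * f a)"
    using finA finD by (rule sum.swap_restrict)
  also have "\<dots> = (\<Sum>\<delta> | \<delta> dvd n. of_int (mu \<delta>) * S \<delta>)"
    by (simp only: S_def sum_distrib_left)
  also have "\<dots> = (\<Sum>\<delta>\<in>deltas n k d. of_int (mu \<delta>) * S \<delta>)"
  proof (rule sum.mono_neutral_right[OF finD])
    show "deltas n k d \<subseteq> {\<delta>. \<delta> dvd n}" by (auto simp: deltas_def)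
    show "\<forall>\<delta>\<in>{\<delta>. \<delta> dvd n} - deltas n k d. of_int (mu \<delta>) * S \<delta> = 0"
    proof
      fix \<delta> assume \<delta>: "\<delta> \<in> {\<delta>. \<delta> dvd n} - deltas n k d"
      show "of_int (mu \<delta>) * S \<delta> = 0"
      proof (cases "coprime \<delta> d")
        case cop: True
        then have "coprime (int \<delta>) (int d)" by simp
        \<comment> \<open>Outside \<open>deltas n k d\<close> nothing is known of \<open>\<delta>' \<delta>\<close>; \<open>y * s\<close> takes its place.\<close>
        then obtain y where "[int \<delta> * y = 1] (mod int d)"
          using cong_solve_coprime_int by blast
        then have "[int \<delta> * y * s = 1 * s] (mod int d)" by (rule cong_scalar_right)
        then have x: "[int \<delta> * (y * s) = s] (mod int d)" by (simp add: mult.assoc)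
        have dvd: "d * \<delta> dvd n" using cop \<delta> assms(3) by (auto simp: coprime_commute intro: divides_mult)
        have "\<not> int (n div (d * \<delta>)) dvd k" using \<delta> cop by (simp add: deltas_def)
        moreover have "{a. a \<in> A \<and> \<delta> dvd a} =
            {a. a \<in> {1..n} \<and> [int a = int \<delta> * (y * s)] (mod int (d * \<delta>))}"
          using cop x by (rule class_eq)
        ultimately have "S \<delta> = 0"
          unfolding S_def f_def using sum_e_residue_class[OF _ dvd] assms(1) by simp
        then show ?thesis by simp
      next
        case ncop: False
        have "{a. a \<in> A \<and> \<delta> dvd a} = {}"
        proof (intro equals0I)
          fix a assume "a \<in> {a. a \<in> A \<and> \<delta> dvd a}"
          then have "[s = int a] (mod int d)" "\<delta> dvd a" by (auto simp: A_def cong_sym)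
          then have "coprime (int a) (int d)" using True cong_imp_coprime by blast
          then have "coprime a d" by simp
          then have "coprime \<delta> d" using \<open>\<delta> dvd a\<close> coprime_divisors[of \<delta> a d d] by simp
          then show False using ncop by simp
        qed
        then show ?thesis by (simp only: S_def sum.empty mult_zero_right)
      qed
    qed
  qed
  also have "\<dots> = (\<Sum>\<delta>\<in>deltas n k d. of_nat n / of_nat d * (of_int (mu \<delta>) / of_nat \<delta> *
          e (of_nat \<delta> * of_int (\<delta>' \<delta>) * of_int k / of_nat n)))"
  proof (rule sum.cong)
    fix \<delta> assume \<delta>: "\<delta> \<in> deltas n k d"
    then have cop: "coprime \<delta> d" and "\<delta> dvd n" and k: "int (n div (d * \<delta>)) dvd k"
      by (auto simp: deltas_def)
    have dvd: "d * \<delta> dvd n"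
      using cop \<open>\<delta> dvd n\<close> assms(3) by (auto simp: coprime_commute intro: divides_mult)
    have "{a. a \<in> A \<and> \<delta> dvd a} =
        {a. a \<in> {1..n} \<and> [int a = int \<delta> * \<delta>' \<delta>] (mod int (d * \<delta>))}"
      using cop assms(4)[OF True \<delta>] by (rule class_eq)
    then have "S \<delta> = of_nat n / of_nat (d * \<delta>) *
        e (of_int (int \<delta> * \<delta>' \<delta>) * of_int k / of_nat n)"
      unfolding S_def f_def using sum_e_residue_class[OF _ dvd] assms(1) k by simp
    then show "of_int (mu \<delta>) * S \<delta> = of_nat n / of_nat d * (of_int (mu \<delta>) / of_nat \<delta> *
          e (of_nat \<delta> * of_int (\<delta>' \<delta>) * of_int k / of_nat n))"
      by (simp add: field_simps)
  qed simp
  finally show ?thesis using True by (simp add: sum_distrib_left)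
qed

end
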